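(* Let $m, n$ be positive integers. For each $i \in \{1,\dots,m\}$ let $h_i : \mathbb{R}^n \to \mathbb{R}\cup\{\infty\}$ be a Legendre function, and suppose that $\bigcap_{i=1}^m \operatorname{int}(\operatorname{dom} h_i)$ is non-empty. Then $h := \sum_{i=1}^m h_i$ is a Legendre function and $$\alpha(h) \in \left[\min_{i\in\{1,\dots,m\}} \{\alpha(h_i)\},\ 1\right].$$
   Context: For $h:\mathbb{R}^n\to\mathbb{R}\cup\{\infty\}$, $\operatorname{dom} h := \{x\in\mathbb{R}^n \mid h(x)<\infty\}$. A proper convex function $h$ is essentially smooth if (i) $S:=\operatorname{int}(\operatorname{dom} h)$ is non-empty, (ii) $h$ is differentiable on $S$, and (iii) for every sequence $(x^{(i)})$ in $S$ converging to a point of the boundary of $S$, $\lim_{i\to\infty}\|\nabla h(x^{(i)})\|_2=\infty$. A function $h$ is a Legendre function if it is proper, closed (lower semicontinuous) and convex, strictly convex on $\operatorname{int}(\operatorname{dom} h)$, and essentially smooth. The Bregman distance is $D_h(x,y) := h(x)-h(y)-\langle\nabla h(y),x-y\rangle$ if $y\in\operatorname{int}(\operatorname{dom} h)$ and $D_h(x,y):=\infty$ otherwise. The symmetry coefficient of a Legendre function $h$ is $$\alpha(h) := \inf\left\{ \frac{D_h(x,y)}{D_h(y,x)} \;\middle|\; x,y\in\operatorname{int}(\operatorname{dom} h),\ x\neq y\right\}.$$ *)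

theory Defs
  imports "HOL-Analysis.Analysis"
begin

text \<open>
  Functions into \<open>\<real> \<union> {\<infinity>}\<close> are modelled as \<^typ>\<open>ereal\<close>-valued functions; the value
  \<open>-\<infinity>\<close> is excluded by \<open>proper_fun\<close>.
\<close>

definition eff_dom :: "('a \<Rightarrow> ereal) \<Rightarrow> 'a set"
  where "eff_dom h = {x. h x < \<infinity>}"

definition proper_fun :: "('a \<Rightarrow> ereal) \<Rightarrow> bool"
  where "proper_fun h \<longleftrightarrow> (\<forall>x. h x \<noteq> -\<infinity>) \<and> eff_dom h \<noteq> {}"

definition convex_fun :: "('a::real_vector \<Rightarrow> ereal) \<Rightarrow> bool"
  where "convex_fun h \<longleftrightarrow>
    (\<forall>x y. \<forall>t\<in>{0<..<1::real}.
      h ((1 - t) *\<^sub>R x + t *\<^sub>R y) \<le> ereal (1 - t) * h x + ereal t * h y)"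

definition strictly_convex_fun_on :: "'a::real_vector set \<Rightarrow> ('a \<Rightarrow> ereal) \<Rightarrow> bool"
  where "strictly_convex_fun_on S h \<longleftrightarrow>
    (\<forall>x\<in>S. \<forall>y\<in>S. x \<noteq> y \<longrightarrow> (\<forall>t\<in>{0<..<1::real}.
      h ((1 - t) *\<^sub>R x + t *\<^sub>R y) < ereal (1 - t) * h x + ereal t * h y))"

definition lsc_fun :: "('a::topological_space \<Rightarrow> ereal) \<Rightarrow> bool"
  where "lsc_fun h \<longleftrightarrow> (\<forall>x. h x \<le> Liminf (at x) h)"

text \<open>
  Differentiability and the gradient refer to the real part of \<open>h\<close>. They are used only at interior
  points of the effective domain of a proper function, where \<open>h\<close> is finite on a neighbourhood.
\<close>

definition gradient :: "('a::real_inner \<Rightarrow> ereal) \<Rightarrow> 'a \<Rightarrow> 'a"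
  where "gradient h x = (THE D. GDERIV (\<lambda>z. real_of_ereal (h z)) x :> D)"

definition essentially_smooth :: "('a::real_inner \<Rightarrow> ereal) \<Rightarrow> bool"
  where "essentially_smooth h \<longleftrightarrow>
    proper_fun h \<and> convex_fun h \<and>
    interior (eff_dom h) \<noteq> {} \<and>
    (\<forall>x\<in>interior (eff_dom h). (\<lambda>z. real_of_ereal (h z)) differentiable (at x)) \<and>
    (\<forall>X l. (\<forall>i::nat. X i \<in> interior (eff_dom h)) \<longrightarrow>
       l \<in> frontier (interior (eff_dom h)) \<longrightarrow> X \<longlonglongrightarrow> l \<longrightarrow>
       filterlim (\<lambda>i. norm (gradient h (X i))) at_top sequentially)"

definition legendre :: "('a::real_inner \<Rightarrow> ereal) \<Rightarrow> bool"
  where "legendre h \<longleftrightarrow>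
    proper_fun h \<and> lsc_fun h \<and> convex_fun h \<and>
    strictly_convex_fun_on (interior (eff_dom h)) h \<and> essentially_smooth h"

definition bregman :: "('a::real_inner \<Rightarrow> ereal) \<Rightarrow> 'a \<Rightarrow> 'a \<Rightarrow> ereal"
  where "bregman h x y =
    (if y \<in> interior (eff_dom h) then h x - h y - ereal (gradient h y \<bullet> (x - y)) else \<infinity>)"

text \<open>
  For a Legendre function and distinct interior points both Bregman distances are finite and
  strictly positive, so the quotient below is an ordinary quotient of positive reals.
\<close>

definition symmetry_coeff :: "('a::real_inner \<Rightarrow> ereal) \<Rightarrow> ereal"
  where "symmetry_coeff h =
    Inf {bregman h x y / bregman h y x | x y.
      x \<in> interior (eff_dom h) \<and> y \<in> interior (eff_dom h) \<and> x \<noteq> y}"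

end

theory Submission
  imports Defs
begin

text \<open>
  Everything reduces to two summands \<open>f\<close> and \<open>g\<close>, because the interior of the effective domain of
  \<open>f + g\<close> is the intersection of the two interiors, so that the hypothesis of a common interior
  point is passed on by induction.

  All parts of the Legendre property are inherited by \<open>f + g\<close> directly, except for the blow-up of
  the gradient at the boundary: there \<open>\<nabla>f\<close> or \<open>\<nabla>g\<close> becomes large, and
  it has to be excluded that the other gradient cancels it. Convexity prevents this. If a ball of
  radius \<open>e\<close> around \<open>z\<close> lies in the domain, then the tangent plane at \<open>x\<close> stays below the graph
  on this ball, and so \<open>\<nabla>f(x) \<bullet> (x - z)\<close> is at least \<open>e * norm (\<nabla>f(x))\<close>
  up to terms bounded for bounded \<open>x\<close> (\<open>convex_gradient_coercive\<close>). A large gradient therefore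
  points away from a common interior point \<open>z\<close>, while the inner product of any other gradient with
  \<open>x - z\<close> stays bounded below, so that the sum of both inner products is large (\<open>norm_gradient_sum_at_top\<close>).

  The Bregman distance is additive in the function and positive for distinct interior points, so the
  quotient for \<open>f + g\<close> is the mediant of the quotients for \<open>f\<close> and \<open>g\<close> and is
  bounded below by one of them (\<open>symmetry_coeff_add\<close>). The upper bound holds for every single
  Legendre function: exchanging \<open>x\<close> and \<open>y\<close> inverts the quotient (\<open>symmetry_coeff_le_1\<close>).
\<close>

section \<open>Gradients of real-valued convex functions\<close>

text \<open>
  Restriction to the line through \<open>x\<close> and \<open>y\<close> reduces this to the one-dimensional tangent inequality.
\<close>

lemma convex_on_above_tangent_plane:
  fixes f :: "'a::real_inner \<Rightarrow> real"
  assumes conv: "convex_on S f" and "open S" and x: "x \<in> S" and y: "y \<in> S"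
    and D: "GDERIV f x :> D"
  shows "f x + D \<bullet> (y - x) \<le> f y"
proof -
  define p where "p t = x + t *\<^sub>R (y - x)" for t :: real
  define A where "A = p -` S"
  have comb: "p (u * s + v * t) = u *\<^sub>R p s + v *\<^sub>R p t" if "u + v = 1" for u v s t
  proof -
    have "u *\<^sub>R p s + v *\<^sub>R p t = (u + v) *\<^sub>R x + (u * s + v * t) *\<^sub>R (y - x)"
      unfolding p_def by (simp add: algebra_simps)
    then show ?thesis using that by (simp add: p_def)
  qed
  have "convex A"
    using conv unfolding A_def convex_on_def convex_def by (auto simp: comb)
  then have conv': "convex_on A (f \<circ> p)"
    using conv unfolding A_def convex_on_def by (auto simp: comb)
  have "open A"
    unfolding A_def p_def by (intro open_vimage \<open>open S\<close> continuous_intros)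
  have "(p has_derivative (\<lambda>t. t *\<^sub>R (y - x))) (at 0)"
    unfolding p_def by (auto intro!: derivative_eq_intros)
  moreover have "(f has_derivative (\<lambda>v. v \<bullet> D)) (at (p 0))"
    using D by (simp add: gderiv_def p_def)
  ultimately have "((\<lambda>t. f (p t)) has_derivative (\<lambda>t. (t *\<^sub>R (y - x)) \<bullet> D)) (at 0)"
    by (rule has_derivative_compose)
  then have deriv: "(f \<circ> p has_field_derivative D \<bullet> (y - x)) (at 0)"
    by (simp add: has_field_derivative_def o_def inner_commute mult_commute_abs)
  have "(D \<bullet> (y - x)) * (1 - 0) \<le> (f \<circ> p) 1 - (f \<circ> p) 0"
    by (rule convex_on_imp_above_tangent[OF conv' convex_connected[OF \<open>convex A\<close>] _ _
          has_field_derivative_at_within[OF deriv]])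
      (use x y \<open>open A\<close> in \<open>simp_all add: interior_open A_def p_def\<close>)
  then show ?thesis by (simp add: p_def)
qed

text \<open>
  Evaluating the tangent plane at \<open>x\<close> in the point of a small ball around \<open>z\<close> that lies furthest in
  the direction of \<open>G x\<close> gains the term \<open>e * norm (G x)\<close>. The remaining terms are harmless: \<open>f\<close> is
  bounded above on the ball, and the tangent plane at \<open>z\<close> bounds \<open>f x\<close> from below.
\<close>

lemma convex_gradient_coercive:
  fixes f :: "'a::euclidean_space \<Rightarrow> real"
  assumes conv: "convex_on S f" and "open S" and z: "z \<in> S"
    and G: "\<And>x. x \<in> S \<Longrightarrow> GDERIV f x :> G x"
  obtains e K C where "e > 0" "C \<ge> 0"
    "\<And>x. x \<in> S \<Longrightarrow> e * norm (G x) \<le> G x \<bullet> (x - z) + K + C * norm (x - z)"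
proof -
  obtain e where e: "e > 0" "cball z e \<subseteq> S"
    using \<open>open S\<close> z open_contains_cball by blast
  have "continuous_on S f"
    using G has_derivative_continuous
    by (metis continuous_at_imp_continuous_on gderiv_def)
  then have "compact (f ` cball z e)"
    using e by (meson compact_cball compact_continuous_image continuous_on_subset)
  then have "bdd_above (f ` cball z e)"
    by (intro bounded_imp_bdd_above compact_imp_bounded)
  then obtain M where M: "\<And>w. w \<in> cball z e \<Longrightarrow> f w \<le> M"
    unfolding bdd_above_def by blast
  show thesis
  proof (rule that[of e "norm (G z)" "M - f z"])
    fix x assume x: "x \<in> S"
    define w where "w = z + e *\<^sub>R sgn (G x)"
    have w: "w \<in> cball z e" using e by (simp add: w_def dist_norm norm_sgn)
    have "f x + G x \<bullet> (w - x) \<le> f w"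
      using convex_on_above_tangent_plane[OF conv \<open>open S\<close> x _ G[OF x]] w e by blast
    also have "f w \<le> M" using M w by blast
    also have "G x \<bullet> (w - x) = e * norm (G x) - G x \<bullet> (x - z)"
      by (cases "G x = 0")
        (simp_all add: w_def sgn_div_norm algebra_simps dot_square_norm power2_eq_square)
    finally have 1: "f x + (e * norm (G x) - G x \<bullet> (x - z)) \<le> M" .
    have "f z + G z \<bullet> (x - z) \<le> f x"
      by (rule convex_on_above_tangent_plane[OF conv \<open>open S\<close> z x G[OF z]])
    moreover have "- (norm (G z) * norm (x - z)) \<le> G z \<bullet> (x - z)"
      using Cauchy_Schwarz_ineq2[of "G z" "x - z"] by linarith
    ultimately show "e * norm (G x) \<le> G x \<bullet> (x - z) + (M - f z) + norm (G z) * norm (x - z)"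
      using 1 by linarith
  qed (use e in auto)
qed

text \<open>
  The inner product of \<open>F x + G x\<close> with \<open>x - z\<close> is at most \<open>R * norm (F x + G x)\<close> along the bounded
  sequence, while by coercivity it is at least a positive multiple of \<open>norm (F x)\<close> up to a constant;
  the contribution of \<open>G\<close> cannot drop below a fixed bound.
\<close>

lemma norm_gradient_sum_at_top:
  fixes f g :: "'a::euclidean_space \<Rightarrow> real"
  assumes f: "convex_on S f" "open S" "\<And>x. x \<in> S \<Longrightarrow> GDERIV f x :> F x"
    and g: "convex_on T g" "open T" "\<And>x. x \<in> T \<Longrightarrow> GDERIV g x :> G x"
    and z: "z \<in> S \<inter> T" and X: "\<And>i::nat. X i \<in> S \<inter> T" "X \<longlonglongrightarrow> l"
    and lim: "filterlim (\<lambda>i. norm (F (X i))) at_top sequentially"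
  shows "filterlim (\<lambda>i. norm (F (X i) + G (X i))) at_top sequentially"
proof -
  obtain e1 K1 C1 where 1: "e1 > 0" "C1 \<ge> 0"
    "\<And>x. x \<in> S \<Longrightarrow> e1 * norm (F x) \<le> F x \<bullet> (x - z) + K1 + C1 * norm (x - z)"
    using convex_gradient_coercive[OF f(1,2) _ f(3)] z by (metis IntD1)
  obtain e2 K2 C2 where 2: "e2 > 0" "C2 \<ge> 0"
    "\<And>x. x \<in> T \<Longrightarrow> e2 * norm (G x) \<le> G x \<bullet> (x - z) + K2 + C2 * norm (x - z)"
    using convex_gradient_coercive[OF g(1,2) _ g(3)] z by (metis IntD2)
  have "(\<lambda>i. X i - z) \<longlonglongrightarrow> l - z" by (intro tendsto_intros X)
  then have "Bseq (\<lambda>i. X i - z)" by (meson convergentI convergent_imp_Bseq)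
  then obtain R where R: "R > 0" "\<And>i. norm (X i - z) \<le> R" unfolding Bseq_def by blast
  define B where "B = K1 + K2 + (C1 + C2) * R"
  have bound: "e1 / R * norm (F (X i)) + - (B / R) \<le> norm (F (X i) + G (X i))" for i
  proof -
    let ?x = "X i"
    have "e1 * norm (F ?x) \<le> F ?x \<bullet> (?x - z) + K1 + C1 * norm (?x - z)"
      using 1(3) X(1) by blast
    moreover have "0 \<le> G ?x \<bullet> (?x - z) + K2 + C2 * norm (?x - z)"
      using 2(1) 2(3)[of ?x] X(1)[of i] by (smt (verit) IntD2 mult_nonneg_nonneg norm_ge_zero)
    moreover have "C1 * norm (?x - z) \<le> C1 * R" "C2 * norm (?x - z) \<le> C2 * R"
      using 1(2) 2(2) R by (auto intro: mult_left_mono)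
    moreover have "(F ?x + G ?x) \<bullet> (?x - z) \<le> norm (F ?x + G ?x) * R"
      by (meson R(2) mult_left_mono norm_cauchy_schwarz norm_ge_zero order_trans)
    ultimately have "e1 * norm (F ?x) \<le> norm (F ?x + G ?x) * R + B"
      unfolding B_def by (simp add: inner_add_left distrib_right)
    then have "(e1 * norm (F ?x) - B) / R \<le> norm (F ?x + G ?x)"
      using R(1) by (simp add: pos_divide_le_eq)
    then show ?thesis by (simp add: diff_divide_distrib)
  qed
  have "filterlim (\<lambda>i. e1 / R * norm (F (X i))) at_top sequentially"
    by (rule filterlim_tendsto_pos_mult_at_top[OF tendsto_const _ lim]) (use 1(1) R(1) in auto)
  then have "filterlim (\<lambda>i. - (B / R) + e1 / R * norm (F (X i))) at_top sequentially"
    by (rule filterlim_tendsto_add_at_top[OF tendsto_const])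
  then show ?thesis
    by (rule filterlim_at_top_mono) (use bound in \<open>simp add: add.commute\<close>)
qed

section \<open>The gradient of an extended real-valued function\<close>

lemma GDERIV_unique:
  assumes "GDERIV f x :> D" "GDERIV f x :> E"
  shows "D = E"
proof -
  have "(\<lambda>v. v \<bullet> D) = (\<lambda>v. v \<bullet> E)"
    using assms unfolding gderiv_def by (rule has_derivative_unique)
  then show ?thesis by (metis inner_commute vector_eq_ldot)
qed

lemma gradient_eqI:
  assumes "GDERIV (\<lambda>z. real_of_ereal (h z)) x :> D"
  shows "gradient h x = D"
  unfolding gradient_def using assms GDERIV_unique by blast

lemma GDERIV_gradient:
  fixes h :: "'a::euclidean_space \<Rightarrow> ereal"
  assumes "(\<lambda>z. real_of_ereal (h z)) differentiable (at x)"
  shows "GDERIV (\<lambda>z. real_of_ereal (h z)) x :> gradient h x"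
proof -
  obtain f' where f': "((\<lambda>z. real_of_ereal (h z)) has_derivative f') (at x)"
    using assms differentiable_def by blast
  \<comment> \<open>The adjoint at \<open>1\<close> is the Riesz representative of the linear functional \<open>f'\<close>.\<close>
  then have "f' = (\<lambda>v. v \<bullet> adjoint f' 1)"
    using adjoint_works[OF has_derivative_linear[OF f']] by auto
  with f' have "GDERIV (\<lambda>z. real_of_ereal (h z)) x :> adjoint f' 1"
    by (simp add: gderiv_def)
  then show ?thesis using gradient_eqI by metis
qed

section \<open>Properness, convexity and semicontinuity of sums\<close>

text \<open>
  In \<^typ>\<open>ereal\<close> the sum \<open>\<infinity> + -\<infinity>\<close> is \<open>\<infinity>\<close>, so a sum lies below \<open>\<infinity>\<close> only if both summands do.
\<close>

lemma eff_dom_add: "eff_dom (\<lambda>x. f x + g x) = eff_dom f \<inter> eff_dom g"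
  by (auto simp: eff_dom_def)

lemma proper_fun_real:
  assumes "proper_fun h" "x \<in> eff_dom h"
  shows "\<exists>r. h x = ereal r"
  using assms by (cases "h x") (auto simp: proper_fun_def eff_dom_def)

lemma proper_fun_real_add:
  assumes "proper_fun f" "proper_fun g" "x \<in> eff_dom f \<inter> eff_dom g"
  shows "real_of_ereal (f x + g x) = real_of_ereal (f x) + real_of_ereal (g x)"
  using proper_fun_real[of f x] proper_fun_real[of g x] assms by auto

lemma convex_eff_dom:
  assumes "convex_fun h"
  shows "convex (eff_dom h)"
proof (rule convexI)
  fix x y and u v :: real
  assume xy: "x \<in> eff_dom h" "y \<in> eff_dom h" and uv: "0 \<le> u" "0 \<le> v" "u + v = 1"
  show "u *\<^sub>R x + v *\<^sub>R y \<in> eff_dom h"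
  proof (cases "v = 0 \<or> v = 1")
    case True
    then show ?thesis using xy uv by auto
  next
    case False
    then have v: "v \<in> {0<..<1}" and u: "u = 1 - v" using uv by auto
    have "h (u *\<^sub>R x + v *\<^sub>R y) \<le> ereal u * h x + ereal v * h y"
      using assms v unfolding u convex_fun_def by blast
    also have "\<dots> < \<infinity>"
      using xy v u by (cases "h x"; cases "h y") (auto simp: eff_dom_def)
    finally show ?thesis by (simp add: eff_dom_def)
  qed
qed

lemma convex_on_real_of_ereal:
  assumes "proper_fun h" "convex_fun h" "S \<subseteq> eff_dom h" "convex S"
  shows "convex_on S (\<lambda>x. real_of_ereal (h x))"
proof (rule convex_onI[OF _ \<open>convex S\<close>])
  fix t :: real and x y
  assume t: "0 < t" "t < 1" and xy: "x \<in> S" "y \<in> S"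
  let ?w = "(1 - t) *\<^sub>R x + t *\<^sub>R y"
  have "?w \<in> S" using t xy \<open>convex S\<close> by (simp add: convexD_alt)
  have "h ?w \<le> ereal (1 - t) * h x + ereal t * h y"
    using assms(2) t by (simp add: convex_fun_def)
  moreover obtain a b c where "h x = ereal a" "h y = ereal b" "h ?w = ereal c"
    using proper_fun_real[OF assms(1)] xy \<open>?w \<in> S\<close> assms(3) by (meson subsetD)
  ultimately show "real_of_ereal (h ?w) \<le> (1 - t) * real_of_ereal (h x) + t * real_of_ereal (h y)"
    by simp
qed

text \<open>
  A bound \<open>y < f x + g x\<close> is split as \<open>y \<le> a + b\<close> with \<open>a < f x\<close> and \<open>b < g x\<close>; each part persists
  near \<open>x\<close>. Such a split exists because neither value is \<open>-\<infinity>\<close>.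
\<close>

lemma lsc_fun_add:
  assumes f: "lsc_fun f" "\<And>x. f x \<noteq> -\<infinity>" and g: "lsc_fun g" "\<And>x. g x \<noteq> -\<infinity>"
  shows "lsc_fun (\<lambda>x. f x + g x)"
  unfolding lsc_fun_def le_Liminf_iff
proof (intro allI impI)
  fix x and y :: ereal
  assume y: "y < f x + g x"
  obtain a b where ab: "a < f x" "b < g x" "y \<le> a + b"
  proof -
    consider "y = -\<infinity>" | r where "y = ereal r" using y by (cases y) auto
    then show ?thesis
    proof cases
      case 1
      obtain a b where "a < f x" "b < g x" using f(2)[of x] g(2)[of x] by (metis ereal_infty_less(2))
      then show ?thesis using that 1 by simp
    next
      case (2 r)
      show ?thesis
      proof (cases "f x")
        case (real p)
        have "ereal (r - p) < g x" using y 2 real by (cases "g x") auto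
        then obtain b where b: "ereal (r - p) < ereal b" "ereal b < g x" using ereal_dense2 by blast
        \<comment> \<open>The slack of \<open>b\<close> over \<open>r - p\<close> is what \<open>a\<close> may lose against \<open>p\<close>.\<close>
        show ?thesis by (rule that[of "ereal (p - (b - (r - p)))" "ereal b"]) (use b real 2 in auto)
      next
        case PInf
        obtain b where "ereal b < g x" using g(2)[of x] by (metis ereal_dense2 ereal_infty_less(2))
        then show ?thesis using PInf 2 by (intro that[of "ereal (r - b)" "ereal b"]) auto
      qed (use f in auto)
    qed
  qed
  have "eventually (\<lambda>z. a < f z) (at x)" "eventually (\<lambda>z. b < g z) (at x)"
    using f(1) g(1) ab unfolding lsc_fun_def le_Liminf_iff by auto
  then show "eventually (\<lambda>z. y < f z + g z) (at x)"
    by eventually_elim (use ab ereal_add_strict_mono2 in \<open>meson order.strict_trans1\<close>)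
qed

lemma convex_fun_add:
  fixes f g :: "'a::real_vector \<Rightarrow> ereal"
  assumes "convex_fun f" "convex_fun g"
  shows "convex_fun (\<lambda>x. f x + g x)"
  unfolding convex_fun_def
proof (intro allI ballI)
  fix x y :: 'a and t :: real assume t: "t \<in> {0<..<1}"
  let ?w = "(1 - t) *\<^sub>R x + t *\<^sub>R y"
  have "f ?w + g ?w \<le> (ereal (1 - t) * f x + ereal t * f y) + (ereal (1 - t) * g x + ereal t * g y)"
    using assms t unfolding convex_fun_def by (intro add_mono) auto
  also have "\<dots> = ereal (1 - t) * (f x + g x) + ereal t * (f y + g y)"
    using t by (simp add: ereal_pos_distrib add_ac)
  finally show "f ?w + g ?w \<le> ereal (1 - t) * (f x + g x) + ereal t * (f y + g y)" .
qed

lemma strictly_convex_fun_on_add: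
  fixes f g :: "'a::real_vector \<Rightarrow> ereal"
  assumes "strictly_convex_fun_on S f" "strictly_convex_fun_on T g"
  shows "strictly_convex_fun_on (S \<inter> T) (\<lambda>x. f x + g x)"
  unfolding strictly_convex_fun_on_def
proof (intro ballI impI)
  fix x y :: 'a and t :: real assume t: "t \<in> {0<..<1}" and xy: "x \<in> S \<inter> T" "y \<in> S \<inter> T" "x \<noteq> y"
  let ?w = "(1 - t) *\<^sub>R x + t *\<^sub>R y"
  have "f ?w + g ?w < (ereal (1 - t) * f x + ereal t * f y) + (ereal (1 - t) * g x + ereal t * g y)"
    using assms t xy unfolding strictly_convex_fun_on_def by (intro ereal_add_strict_mono2) auto
  also have "\<dots> = ereal (1 - t) * (f x + g x) + ereal t * (f y + g y)"
    using t by (simp add: ereal_pos_distrib add_ac)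
  finally show "f ?w + g ?w < ereal (1 - t) * (f x + g x) + ereal t * (f y + g y)" .
qed

section \<open>Sums of Legendre functions\<close>

lemma legendre_interior:
  fixes h :: "'a::euclidean_space \<Rightarrow> ereal"
  assumes "legendre h"
  shows "proper_fun h"
    and "convex_on (interior (eff_dom h)) (\<lambda>x. real_of_ereal (h x))"
    and "\<And>x. x \<in> interior (eff_dom h) \<Longrightarrow> GDERIV (\<lambda>x. real_of_ereal (h x)) x :> gradient h x"
    and "\<And>x. x \<in> interior (eff_dom h) \<Longrightarrow> \<exists>r. h x = ereal r"
proof -
  show p: "proper_fun h" using assms by (simp add: legendre_def)
  have "convex_fun h" using assms by (simp add: legendre_def)
  then show "convex_on (interior (eff_dom h)) (\<lambda>x. real_of_ereal (h x))"
    by (intro convex_on_real_of_ereal p) (simp_all add: interior_subset convex_eff_dom)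
  show "GDERIV (\<lambda>x. real_of_ereal (h x)) x :> gradient h x" if "x \<in> interior (eff_dom h)" for x
    using assms that by (intro GDERIV_gradient) (simp add: legendre_def essentially_smooth_def)
  show "\<exists>r. h x = ereal r" if "x \<in> interior (eff_dom h)" for x
    by (rule proper_fun_real[OF p subsetD[OF interior_subset that]])
qed

lemma GDERIV_legendre_add:
  fixes f g :: "'a::euclidean_space \<Rightarrow> ereal"
  assumes f: "legendre f" and g: "legendre g"
    and x: "x \<in> interior (eff_dom f) \<inter> interior (eff_dom g)"
  shows "GDERIV (\<lambda>z. real_of_ereal (f z + g z)) x :> gradient f x + gradient g x"
proof -
  let ?S = "interior (eff_dom f) \<inter> interior (eff_dom g)"
  have "((\<lambda>z. real_of_ereal (f z) + real_of_ereal (g z)) has_derivative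
      (\<lambda>v. v \<bullet> (gradient f x + gradient g x))) (at x)"
    using GDERIV_add[OF legendre_interior(3)[OF f] legendre_interior(3)[OF g]] x
    by (simp add: gderiv_def)
  then have "((\<lambda>z. real_of_ereal (f z + g z)) has_derivative
      (\<lambda>v. v \<bullet> (gradient f x + gradient g x))) (at x)"
  proof (rule has_derivative_transform_within_open)
    show "open ?S" by auto
    fix z assume "z \<in> ?S"
    then have "z \<in> eff_dom f \<inter> eff_dom g" using interior_subset by blast
    then show "real_of_ereal (f z) + real_of_ereal (g z) = real_of_ereal (f z + g z)"
      using proper_fun_real_add legendre_interior(1) f g by metis
  qed (use x in auto)
  then show ?thesis by (simp add: gderiv_def)
qed

text \<open>
  A boundary point of the intersection of the two interiors is a boundary point of one of them, which
  makes that gradient blow up; the other one cannot compensate by \<open>norm_gradient_sum_at_top\<close>.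
\<close>

lemma legendre_add:
  fixes f g :: "'a::euclidean_space \<Rightarrow> ereal"
  assumes f: "legendre f" and g: "legendre g"
    and ne: "interior (eff_dom f) \<inter> interior (eff_dom g) \<noteq> {}"
  shows "legendre (\<lambda>x. f x + g x)"
proof -
  let ?h = "\<lambda>x. f x + g x"
  define S where "S = interior (eff_dom f)"
  define T where "T = interior (eff_dom g)"
  have dom: "interior (eff_dom ?h) = S \<inter> T"
    by (simp add: eff_dom_add S_def T_def)
  have pf: "proper_fun f" and pg: "proper_fun g" using f g by (simp_all add: legendre_def)
  have proper: "proper_fun ?h"
    using pf pg ne interior_subset[of "eff_dom f"] interior_subset[of "eff_dom g"]
    unfolding proper_fun_def by (auto simp: eff_dom_add)
  have conv: "convex_fun ?h" using f g by (simp add: legendre_def convex_fun_add)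
  have grad: "gradient ?h x = gradient f x + gradient g x" if "x \<in> S \<inter> T" for x
    using GDERIV_legendre_add[OF f g] that by (intro gradient_eqI) (simp add: S_def T_def)
  have "essentially_smooth ?h"
    unfolding essentially_smooth_def dom
  proof (intro conjI ballI allI impI)
    fix x assume "x \<in> S \<inter> T"
    then show "(\<lambda>z. real_of_ereal (f z + g z)) differentiable (at x)"
      using GDERIV_legendre_add[OF f g] unfolding gderiv_def differentiable_def S_def T_def by blast
  next
    fix X :: "nat \<Rightarrow> 'a" and l
    assume X: "\<forall>i. X i \<in> S \<inter> T" and l: "l \<in> frontier (S \<inter> T)" and lim: "X \<longlonglongrightarrow> l"
    obtain z where z: "z \<in> S \<inter> T" using ne S_def T_def by blast
    note F = legendre_interior(2)[OF f, folded S_def] open_interior[of "eff_dom f", folded S_def]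
      legendre_interior(3)[OF f, folded S_def]
    note G = legendre_interior(2)[OF g, folded T_def] open_interior[of "eff_dom g", folded T_def]
      legendre_interior(3)[OF g, folded T_def]
    have "filterlim (\<lambda>i. norm (gradient f (X i) + gradient g (X i))) at_top sequentially"
    proof (cases "l \<in> frontier S")
      case True
      then have "filterlim (\<lambda>i. norm (gradient f (X i))) at_top sequentially"
        using f X lim unfolding legendre_def essentially_smooth_def S_def by blast
      with F G z X lim show ?thesis
        by (intro norm_gradient_sum_at_top[where S = S and T = T and z = z and l = l and X = X]) auto
    next
      case False
      then have "l \<in> frontier T" using l frontier_Int_subset by blast
      then have "filterlim (\<lambda>i. norm (gradient g (X i))) at_top sequentially"
        using g X lim unfolding legendre_def essentially_smooth_def T_def by blast
      with F G z X lim have "filterlim (\<lambda>i. norm (gradient g (X i) + gradient f (X i))) at_top sequentially"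
        by (intro norm_gradient_sum_at_top[where S = T and T = S and z = z and l = l and X = X]) auto
      then show ?thesis by (simp add: add.commute)
    qed
    then show "filterlim (\<lambda>i. norm (gradient ?h (X i))) at_top sequentially"
      using grad X by simp
  qed (use proper conv ne in \<open>auto simp: S_def T_def\<close>)
  moreover have "lsc_fun ?h"
    using f g pf pg by (intro lsc_fun_add) (auto simp: legendre_def proper_fun_def)
  moreover have "strictly_convex_fun_on (S \<inter> T) ?h"
    using f g by (intro strictly_convex_fun_on_add) (simp_all add: legendre_def S_def T_def)
  ultimately show ?thesis
    using proper conv by (simp add: legendre_def dom)
qed

section \<open>Bregman distances and the symmetry coefficient\<close>

text \<open>
  The tangent plane at \<open>y\<close> lies weakly below \<open>h\<close> at the midpoint \<open>w\<close>, and \<open>h w\<close> lies strictly below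
  the chord; comparing both at \<open>w\<close> gives strict inequality at \<open>x\<close>.
\<close>

lemma bregman_pos:
  fixes h :: "'a::euclidean_space \<Rightarrow> ereal"
  assumes h: "legendre h" and x: "x \<in> interior (eff_dom h)" and y: "y \<in> interior (eff_dom h)"
    and "x \<noteq> y"
  obtains r where "bregman h x y = ereal r" "r > 0"
proof -
  let ?S = "interior (eff_dom h)"
  note conv = legendre_interior(2)[OF h]
  define w where "w = (1 - 1/2) *\<^sub>R x + (1/2::real) *\<^sub>R y"
  have w: "w \<in> ?S"
    unfolding w_def using conv x y by (intro convexD_alt) (auto simp: convex_on_def)
  obtain a b c where abc: "h x = ereal a" "h y = ereal b" "h w = ereal c"
    using legendre_interior(4)[OF h] x y w by meson
  have "strictly_convex_fun_on ?S h" using h by (simp add: legendre_def)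
  moreover have "(1/2::real) \<in> {0<..<1}" by simp
  ultimately have "h w < ereal (1 - 1/2) * h x + ereal (1/2) * h y"
    using x y \<open>x \<noteq> y\<close> unfolding w_def strictly_convex_fun_on_def by blast
  then have "c < (a + b) / 2" by (simp add: abc add_divide_distrib)
  moreover have "b + gradient h y \<bullet> (w - y) \<le> c"
    using convex_on_above_tangent_plane[OF conv open_interior y w legendre_interior(3)[OF h y]]
    by (simp add: abc)
  moreover have "w - y = (1/2) *\<^sub>R (x - y)"
    by (simp add: w_def algebra_simps flip: scaleR_add_left)
  ultimately have "a - b - gradient h y \<bullet> (x - y) > 0" by simp
  moreover have "bregman h x y = ereal (a - b - gradient h y \<bullet> (x - y))"
    using y by (simp add: bregman_def abc)
  ultimately show thesis using that by blast
qed

lemma bregman_add: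
  fixes f g :: "'a::euclidean_space \<Rightarrow> ereal"
  assumes f: "legendre f" and g: "legendre g"
    and x: "x \<in> interior (eff_dom f) \<inter> interior (eff_dom g)"
    and y: "y \<in> interior (eff_dom f) \<inter> interior (eff_dom g)"
  shows "bregman (\<lambda>x. f x + g x) x y = bregman f x y + bregman g x y"
proof -
  obtain a b c d where "f x = ereal a" "f y = ereal b" "g x = ereal c" "g y = ereal d"
    using x y legendre_interior(4)[OF f] legendre_interior(4)[OF g] by (meson IntD1 IntD2)
  moreover have "gradient (\<lambda>x. f x + g x) y = gradient f y + gradient g y"
    using GDERIV_legendre_add[OF f g y] by (rule gradient_eqI)
  ultimately show ?thesis
    using y by (simp add: bregman_def eff_dom_add inner_add_left)
qed

text \<open>
  For positive reals the mediant \<open>(a + b) / (a' + b')\<close> is at least one of \<open>a / a'\<close> and \<open>b / b'\<close>.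
\<close>

lemma symmetry_coeff_add:
  fixes f g :: "'a::euclidean_space \<Rightarrow> ereal"
  assumes f: "legendre f" and g: "legendre g"
  shows "min (symmetry_coeff f) (symmetry_coeff g) \<le> symmetry_coeff (\<lambda>x. f x + g x)"
  unfolding symmetry_coeff_def[of "\<lambda>x. f x + g x"]
proof (rule Inf_greatest, clarify)
  let ?h = "\<lambda>x. f x + g x"
  fix x y
  assume "x \<in> interior (eff_dom ?h)" "y \<in> interior (eff_dom ?h)" and ne: "x \<noteq> y"
  then have x: "x \<in> interior (eff_dom f) \<inter> interior (eff_dom g)"
    and y: "y \<in> interior (eff_dom f) \<inter> interior (eff_dom g)"
    by (simp_all add: eff_dom_add)
  obtain a a' where a: "bregman f x y = ereal a" "a > 0" "bregman f y x = ereal a'" "a' > 0"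
    using bregman_pos[OF f] x y ne by (metis IntD1)
  obtain b b' where b: "bregman g x y = ereal b" "b > 0" "bregman g y x = ereal b'" "b' > 0"
    using bregman_pos[OF g] x y ne by (metis IntD2)
  have "symmetry_coeff f \<le> bregman f x y / bregman f y x"
    unfolding symmetry_coeff_def using x y ne by (intro Inf_lower) blast
  then have "symmetry_coeff f \<le> ereal (a / a')" using a by simp
  moreover have "symmetry_coeff g \<le> bregman g x y / bregman g y x"
    unfolding symmetry_coeff_def using x y ne by (intro Inf_lower) blast
  then have "symmetry_coeff g \<le> ereal (b / b')" using b by simp
  moreover have "a / a' \<le> (a + b) / (a' + b') \<or> b / b' \<le> (a + b) / (a' + b')"
    using a b by (simp add: field_simps) linarith
  ultimately have "min (symmetry_coeff f) (symmetry_coeff g) \<le> ereal ((a + b) / (a' + b'))"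
    by (metis ereal_less_eq(3) min.coboundedI1 min.coboundedI2 order_trans)
  also have "\<dots> = bregman ?h x y / bregman ?h y x"
    using a b by (simp add: bregman_add[OF f g x y] bregman_add[OF f g y x])
  finally show "min (symmetry_coeff f) (symmetry_coeff g) \<le> bregman ?h x y / bregman ?h y x" .
qed

text \<open>
  The defining set contains with each quotient its reciprocal, and one of the two is at most \<open>1\<close>. A
  nonempty open set in a Euclidean space of positive dimension contains two distinct points, so the
  infimum is not taken over the empty set.
\<close>

lemma symmetry_coeff_le_1:
  fixes h :: "'a::euclidean_space \<Rightarrow> ereal"
  assumes h: "legendre h"
  shows "symmetry_coeff h \<le> 1"
proof -
  let ?S = "interior (eff_dom h)"
  obtain x where x: "x \<in> ?S"
    using h unfolding legendre_def essentially_smooth_def by blast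
  then have "\<not> finite ?S"
    using open_interior finite_imp_not_open by blast
  then obtain y where y: "y \<in> ?S" "y \<noteq> x"
    by (metis finite.emptyI finite_insert finite_subset insertCI subsetI)
  obtain a b where a: "bregman h x y = ereal a" "a > 0" and b: "bregman h y x = ereal b" "b > 0"
    using bregman_pos[OF h] x y by metis
  have "symmetry_coeff h \<le> bregman h x y / bregman h y x"
    "symmetry_coeff h \<le> bregman h y x / bregman h x y"
    unfolding symmetry_coeff_def using x y by (intro Inf_lower; blast)+
  then have "symmetry_coeff h \<le> ereal (a / b)" "symmetry_coeff h \<le> ereal (b / a)"
    using a b by simp_all
  moreover have "a / b \<le> 1 \<or> b / a \<le> 1" using a b by (simp add: field_simps) linarith
  ultimately show ?thesis
    by (metis ereal_less_eq(3) one_ereal_def order_trans)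
qed

lemma legendre_sum:
  fixes h :: "'i \<Rightarrow> 'a::euclidean_space \<Rightarrow> ereal"
  assumes "finite I" "I \<noteq> {}" and "\<And>i. i \<in> I \<Longrightarrow> legendre (h i)"
    and "(\<Inter>i\<in>I. interior (eff_dom (h i))) \<noteq> {}"
  shows "legendre (\<lambda>x. \<Sum>i\<in>I. h i x)"
    and "(MIN i\<in>I. symmetry_coeff (h i)) \<le> symmetry_coeff (\<lambda>x. \<Sum>i\<in>I. h i x)"
proof -
  \<comment> \<open>The domain of the partial sum is carried along, since adding the next summand requires a
    common interior point.\<close>
  have "legendre (\<lambda>x. \<Sum>i\<in>I. h i x) \<and>
      interior (eff_dom (\<lambda>x. \<Sum>i\<in>I. h i x)) = (\<Inter>i\<in>I. interior (eff_dom (h i))) \<and>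
      (MIN i\<in>I. symmetry_coeff (h i)) \<le> symmetry_coeff (\<lambda>x. \<Sum>i\<in>I. h i x)"
    using assms
  proof (induction rule: finite_ne_induct)
    case (singleton i)
    then show ?case by simp
  next
    case (insert i I)
    let ?s = "\<lambda>x. \<Sum>j\<in>I. h j x"
    have IH: "legendre ?s" "interior (eff_dom ?s) = (\<Inter>j\<in>I. interior (eff_dom (h j)))"
      "(MIN j\<in>I. symmetry_coeff (h j)) \<le> symmetry_coeff ?s"
      using insert by auto
    have i: "legendre (h i)" using insert by simp
    have sum: "(\<lambda>x. \<Sum>j\<in>insert i I. h j x) = (\<lambda>x. h i x + ?s x)"
      using insert by simp
    have dom: "interior (eff_dom (\<lambda>x. h i x + ?s x)) = (\<Inter>j\<in>insert i I. interior (eff_dom (h j)))"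
      using IH by (simp add: eff_dom_add)
    have "legendre (\<lambda>x. h i x + ?s x)"
      using insert.prems IH by (intro legendre_add i) auto
    moreover have "(MIN j\<in>insert i I. symmetry_coeff (h j)) =
        min (symmetry_coeff (h i)) (MIN j\<in>I. symmetry_coeff (h j))"
      using insert.hyps by simp
    then have "(MIN j\<in>insert i I. symmetry_coeff (h j)) \<le> min (symmetry_coeff (h i)) (symmetry_coeff ?s)"
      using IH(3) by (metis min.mono order_refl)
    then have "(MIN j\<in>insert i I. symmetry_coeff (h j)) \<le> symmetry_coeff (\<lambda>x. h i x + ?s x)"
      using symmetry_coeff_add[OF i IH(1)] by (rule order_trans)
    ultimately show ?case unfolding sum dom by blast
  qed
  then show "legendre (\<lambda>x. \<Sum>i\<in>I. h i x)"
    and "(MIN i\<in>I. symmetry_coeff (h i)) \<le> symmetry_coeff (\<lambda>x. \<Sum>i\<in>I. h i x)"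
    by blast+
qed

theorem proposition2p2:
  fixes m :: nat
    and h :: "nat \<Rightarrow> real ^ 'n \<Rightarrow> ereal"
  assumes "m \<ge> 1"
    and "\<And>i. i \<in> {1..m} \<Longrightarrow> legendre (h i)"
    and "(\<Inter>i\<in>{1..m}. interior (eff_dom (h i))) \<noteq> {}"
  shows "legendre (\<lambda>x. \<Sum>i=1..m. h i x) \<and>
    symmetry_coeff (\<lambda>x. \<Sum>i=1..m. h i x) \<in> {(MIN i\<in>{1..m}. symmetry_coeff (h i))..1}"
proof -
  have "{1..m} \<noteq> {}" using assms(1) by simp
  note * = legendre_sum[OF finite_atLeastAtMost this assms(2,3)]
  show ?thesis using *(1) *(2) symmetry_coeff_le_1[OF *(1)] by simp
qed

end
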